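(* Let $A$ be a real $m\times n$ matrix and $b\in\mathcal{R}(A)$, so that the system $Ax=b$ is consistent. Let $\Gamma$ be a real $m\times q$ matrix, put $\bar n=n+q$ and $\bar A=[A\ \ \Gamma]$ (an $m\times\bar n$ matrix), and suppose $\bar A$ is partitioned into consecutive row blocks $\bar A_1,\dots,\bar A_p$, where $\bar A_i=[A_i\ \ \Gamma_i]$ and $A_i,\Gamma_i$ are the corresponding row blocks of $A$ and $\Gamma$, such that $\bar A_i\bar A_j^T=0$ for all $i\neq j$. Let $P=P_{\mathcal{R}(\bar A^T)}=\bar A^+\bar A$ be the orthogonal projector of $\mathbb{R}^{\bar n}$ onto $\mathcal{R}(\bar A^T)$, let $Y=[0\ \ I_q]$ (a $q\times\bar n$ matrix, with $0$ of size $q\times n$), and let $$W=Y(I-P)=[B\ \ S],$$ where $B$ is the $q\times n$ block formed by the first $n$ columns of $W$ and $S$ is the $q\times q$ block formed by its last $q$ columns. Then: (i) $W$ is orthogonal to $\bar A$, i.e. $\bar A W^T=0$, and hence to each row block, i.e. $\bar A_iW^T=0$ for $i=1,\dots,p$. (ii) The following equalities hold: $$\begin{bmatrix}\bar A\\ W\end{bmatrix}^+=[\bar A^+\ \ W^+]\qquad\text{and}\qquad WW^T=BB^T+S^2=S,\quad\text{where } S=Y(I-P)Y^T.$$ (iii) Suppose that the matrix $S$ is invertible and let $f=-Y\bar A^+b\in\mathbb{R}^q$. Consider the linear system $$\begin{bmatrix}A&\Gamma\\ B&S\end{bmatrix}\begin{bmatrix}x\\ y\end{bmatrix}=\begin{bmatrix}b\\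 f\end{bmatrix},\qquad x\in\mathbb{R}^n,\ y\in\mathbb{R}^q.\qquad(\ast)$$ If $x$ is a solution of $Ax=b$, then $\begin{bmatrix}x\\ 0\end{bmatrix}$ is a solution of $(\ast)$. Conversely, if $\begin{bmatrix}x\\ y\end{bmatrix}$ is the minimal norm solution of $(\ast)$, then $y=0$ and $x$ is a solution of $Ax=b$.
   Context: All matrices and vectors are real. $M^T$, $M^+$ and $\mathcal{R}(M)$ denote the transpose, the Moore-Penrose pseudoinverse and the range (column space) of a matrix $M$; $I_q$ is the $q\times q$ identity matrix and $I$ is the identity matrix of the appropriate size. $P_V$ denotes the orthogonal projector onto a vector subspace $V$. The minimal norm solution of a consistent linear system is its unique solution of smallest Euclidean norm. *)

theory Defs
  imports Complex_Main
    "Jordan_Normal_Form.Matrix"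
    "Jordan_Normal_Form.VS_Connect"
    "Jordan_Normal_Form.DL_Submatrix"
begin

definition append_cols :: "'a :: zero mat \<Rightarrow> 'a mat \<Rightarrow> 'a mat" (infixr \<open>@\<^sub>c\<close> 65) where
  "A @\<^sub>c B = four_block_mat A B (0\<^sub>m 0 (dim_col A)) (0\<^sub>m 0 (dim_col B))"

text \<open>Rows are counted from 0; the upper bound \<open>u\<close> is exclusive.\<close>

definition row_block :: "'a mat \<Rightarrow> nat \<Rightarrow> nat \<Rightarrow> 'a mat" where
  "row_block A l u = submatrix A {l..<u} UNIV"

text \<open>The four Penrose equations. They determine \<open>X\<close> uniquely, and for every real matrix
  they have a solution, so \<open>pinv\<close> is well defined.\<close>

definition is_pinv :: "real mat \<Rightarrow> real mat \<Rightarrow> bool" where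
  "is_pinv A X \<longleftrightarrow> X \<in> carrier_mat (dim_col A) (dim_row A)
     \<and> A * X * A = A \<and> X * A * X = X
     \<and> (A * X)\<^sup>T = A * X \<and> (X * A)\<^sup>T = X * A"

definition pinv :: "real mat \<Rightarrow> real mat" where
  "pinv A = (THE X. is_pinv A X)"

definition is_orth_proj :: "nat \<Rightarrow> real vec set \<Rightarrow> real mat \<Rightarrow> bool" where
  "is_orth_proj n V Q \<longleftrightarrow> Q \<in> carrier_mat n n
     \<and> (\<forall>v \<in> carrier_vec n. Q *\<^sub>v v \<in> V \<and> (\<forall>u \<in> V. (v - Q *\<^sub>v v) \<bullet> u = 0))"

definition orth_proj :: "nat \<Rightarrow> real vec set \<Rightarrow> real mat" where
  "orth_proj n V = (THE Q. is_orth_proj n V Q)"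

definition euclidean_norm :: "real vec \<Rightarrow> real" where
  "euclidean_norm v = sqrt (v \<bullet> v)"

definition is_solution :: "real mat \<Rightarrow> real vec \<Rightarrow> real vec \<Rightarrow> bool" where
  "is_solution M c z \<longleftrightarrow> z \<in> carrier_vec (dim_col M) \<and> M *\<^sub>v z = c"

text \<open>A consistent system has exactly one solution of smallest norm, so uniqueness need not
  be demanded here.\<close>

definition is_min_norm_solution :: "real mat \<Rightarrow> real vec \<Rightarrow> real vec \<Rightarrow> bool" where
  "is_min_norm_solution M c z \<longleftrightarrow> is_solution M c z
     \<and> (\<forall>w. is_solution M c w \<longrightarrow> euclidean_norm z \<le> euclidean_norm w)"

lemma pick_atLeastLessThan:
  assumes "k < u - l"
  shows "pick {l..<u} k = l + k"
proof -
  have "{a \<in> {l..<u}. a < l + k} = {l..<l + k}"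
    using assms by auto
  then have "card {a \<in> {l..<u}. a < l + k} = k"
    by simp
  then show ?thesis
    using pick_card_in_set[of "l + k" "{l..<u}"] assms by simp
qed

lemma row_block_eq:
  assumes "u \<le> dim_row A"
  shows "row_block A l u = mat (u - l) (dim_col A) (\<lambda>(i, j). A $$ (l + i, j))"
proof -
  have "{i. i < dim_row A \<and> i \<in> {l..<u}} = {l..<u}"
    using assms by auto
  then have c: "card {i. i < dim_row A \<and> i \<in> {l..<u}} = u - l"
    by simp
  show ?thesis
    unfolding row_block_def submatrix_def c
    by (rule eq_matI) (auto simp: pick_atLeastLessThan pick_UNIV)
qed

lemma row_block_append_cols:
  assumes "A \<in> carrier_mat m n" "G \<in> carrier_mat m q" "u \<le> m"
  shows "row_block (A @\<^sub>c G) l u = row_block A l u @\<^sub>c row_block G l u"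
  using assms by (auto simp: row_block_eq append_cols_def intro!: eq_matI)

end

theory Submission
  imports Defs
begin

text \<open>
  Put \<open>Q = I - P\<close>. Since \<open>Q\<close> is symmetric, idempotent and annihilated by \<open>Abar\<close>, the rows of
  \<open>W = Y Q\<close> are orthogonal to those of \<open>Abar\<close>, and \<open>W W\<^sup>T = Y Q Y\<^sup>T = S\<close>. Orthogonality of the
  rows makes the pseudoinverse of the stacked matrix split, by the Penrose equations. Finally
  \<open>Abar z = b\<close> gives \<open>W z = Y z - Y Abar\<^sup>+ b = y + f\<close> for \<open>z = (x, y)\<close>, so the second block of the
  system says exactly that \<open>y = 0\<close>.
\<close>

section \<open>Matrix algebra: reassociation, transposes and cancellation\<close>

text \<open>Side conditions on dimensions alone leave no carrier sizes to instantiate, so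
  \<open>simp\<close> can reassociate products whose inner sizes are not displayed.\<close>

lemma mult_mat_assoc_dim:
  fixes A B C :: "'a :: semiring_0 mat"
  assumes "dim_col A = dim_row B" "dim_col B = dim_row C"
  shows "A * B * C = A * (B * C)"
  by (rule assoc_mult_mat[of A "dim_row A" "dim_row B" B "dim_row C" C "dim_col C"])
    (use assms in \<open>auto intro: carrier_matI\<close>)

lemma transpose_mult_dim:
  fixes A B :: "'a :: comm_semiring_0 mat"
  assumes "dim_col A = dim_row B"
  shows "(A * B)\<^sup>T = B\<^sup>T * A\<^sup>T"
  by (rule transpose_mult[of A "dim_row A" "dim_row B" B "dim_col B"])
    (use assms in \<open>auto intro: carrier_matI\<close>)

lemma scalar_prod_self_eq_0_iff:
  fixes v :: "real vec"
  shows "v \<bullet> v = 0 \<longleftrightarrow> v = 0\<^sub>v (dim_vec v)"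
proof
  assume "v \<bullet> v = 0"
  then have "\<forall>i\<in>{0..<dim_vec v}. v $ i * v $ i = 0"
    unfolding scalar_prod_def by (subst (asm) sum_nonneg_eq_0_iff) auto
  then show "v = 0\<^sub>v (dim_vec v)"
    by (intro eq_vecI) auto
next
  assume "v = 0\<^sub>v (dim_vec v)"
  then show "v \<bullet> v = 0"
    by (metis carrier_vec_dim_vec scalar_prod_left_zero)
qed

text \<open>The diagonal entries of \<open>A\<^sup>T * A\<close> are the squared norms of the
  columns of \<open>A\<close>.\<close>

lemma transpose_mult_self_eq_0:
  fixes A :: "real mat"
  assumes A: "A \<in> carrier_mat m n" and eq: "A\<^sup>T * A = 0\<^sub>m n n"
  shows "A = 0\<^sub>m m n"
proof (rule eq_matI)
  fix i j assume ij: "i < dim_row (0\<^sub>m m n)" "j < dim_col (0\<^sub>m m n)"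
  then have "col A j \<bullet> col A j = (A\<^sup>T * A) $$ (j, j)"
    using A by simp
  then have "col A j = 0\<^sub>v m"
    using ij A eq scalar_prod_self_eq_0_iff[of "col A j"] by simp
  then have "col A j $ i = 0"
    using ij by simp
  then show "A $$ (i, j) = 0\<^sub>m m n $$ (i, j)"
    using ij A by simp
qed (use A in auto)

text \<open>The difference \<open>D = A * (X - Z)\<close> satisfies
  \<open>D\<^sup>T * D = (X - Z)\<^sup>T * (A\<^sup>T * D)\<close>, and the last factor is zero by
  \<open>eq\<close>. Two such cancellations produce the first Penrose equation in
  \<open>ex_is_pinv\<close>.\<close>

lemma transpose_mult_cancel_left:
  fixes A X Z :: "real mat"
  assumes A: "A \<in> carrier_mat m n" and X: "X \<in> carrier_mat n k" and Z: "Z \<in> carrier_mat n k"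
    and eq: "A\<^sup>T * (A * X) = A\<^sup>T * (A * Z)"
  shows "A * X = A * Z"
proof -
  define D where "D = A * X - A * Z"
  have D: "D \<in> carrier_mat m k"
    using A X Z by (auto simp: D_def)
  have "D = A * (X - Z)"
    using A X Z by (simp add: D_def mult_minus_distrib_mat)
  then have "D\<^sup>T * D = (X - Z)\<^sup>T * (A\<^sup>T * D)"
    using A X Z D by (simp add: transpose_mult_dim mult_mat_assoc_dim)
  also have "A\<^sup>T * D = A\<^sup>T * (A * X) - A\<^sup>T * (A * Z)"
    using A X Z by (simp add: D_def mult_minus_distrib_mat[of _ n m _ k])
  also have "\<dots> = 0\<^sub>m n k"
    unfolding eq using A X Z by (intro minus_r_inv_mat) auto
  also have "(X - Z)\<^sup>T * 0\<^sub>m n k = 0\<^sub>m k k"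
    using X Z by simp
  finally have "D = 0\<^sub>m m k"
    by (rule transpose_mult_self_eq_0[OF D])
  then have zero: "(A * X - A * Z) $$ (i, j) = 0" if "i < m" "j < k" for i j
    using that unfolding D_def by simp
  show ?thesis
  proof (rule eq_matI)
    fix i j assume "i < dim_row (A * Z)" "j < dim_col (A * Z)"
    then show "(A * X) $$ (i, j) = (A * Z) $$ (i, j)"
      using zero[of i j] A X Z by simp
  qed (use A X Z in auto)
qed

section \<open>Existence and uniqueness of the pseudoinverse\<close>

text \<open>Wedderburn's rank reduction: subtracting \<open>A e\<^sub>j e\<^sub>i\<^sup>T A / a\<^sub>i\<^sub>j\<close> for a nonzero entry \<open>a\<^sub>i\<^sub>j\<close>
  clears column \<open>j\<close> and keeps the zero columns zero.\<close>

lemma ex_generalized_inverse: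
  fixes A :: "'a :: field mat"
  assumes "A \<in> carrier_mat m n"
  shows "\<exists>G \<in> carrier_mat n m. A * G * A = A"
  using assms
proof (induction "card {k. k < n \<and> col A k \<noteq> 0\<^sub>v m}" arbitrary: A rule: less_induct)
  case (less A)
  show ?case
  proof (cases "A = 0\<^sub>m m n")
    case True
    then show ?thesis
      by (intro bexI[of _ "0\<^sub>m n m"]) auto
  next
    case False
    then obtain i j where ij: "i < m" "j < n" and nz: "A $$ (i, j) \<noteq> 0"
      using less.prems by (metis carrier_matD eq_matI index_zero_mat)
    define a where "a = inverse (A $$ (i, j))"
    \<comment> \<open>\<open>E\<close> is a matrix unit scaled by \<open>a\<close>. As
      \<open>a * A $$ (i, j) = 1\<close>, the product \<open>F\<close> agrees with \<open>A\<close>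
      in column \<open>j\<close>, and it vanishes in every column in which \<open>A\<close>
      does.\<close>
    define E F where "E = mat n m (\<lambda>(k, l). if k = j \<and> l = i then a else 0)"
      and "F = A * E * A"
    have E: "E \<in> carrier_mat n m"
      by (simp add: E_def)
    have F: "F \<in> carrier_mat m n"
      using less.prems E by (simp add: F_def)
    have AE: "(A * E) $$ (k, l) = (if l = i then a * A $$ (k, j) else 0)" if "k < m" "l < m" for k l
    proof -
      have "(A * E) $$ (k, l) = (\<Sum>t = 0..<n. A $$ (k, t) * E $$ (t, l))"
        using that less.prems E by (simp add: scalar_prod_def)
      also have "\<dots> = (\<Sum>t = 0..<n. if t = j then (if l = i then a * A $$ (k, j) else 0) else 0)"
        using that by (intro sum.cong) (auto simp: E_def)
      finally show ?thesis
        using ij by simp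
    qed
    have F_index: "F $$ (k, l) = a * A $$ (k, j) * A $$ (i, l)" if "k < m" "l < n" for k l
    proof -
      have "F $$ (k, l) = (\<Sum>t = 0..<m. (A * E) $$ (k, t) * A $$ (t, l))"
        using that less.prems E by (simp add: F_def scalar_prod_def del: assoc_mult_mat)
      also have "\<dots> = (\<Sum>t = 0..<m. if t = i then a * A $$ (k, j) * A $$ (i, l) else 0)"
        using that AE by (intro sum.cong) auto
      finally show ?thesis
        using ij by simp
    qed
    let ?C = "A - F"
    have C: "?C \<in> carrier_mat m n"
      by (rule minus_carrier_mat[OF F])
    have "{k. k < n \<and> col ?C k \<noteq> 0\<^sub>v m} \<subset> {k. k < n \<and> col A k \<noteq> 0\<^sub>v m}"
    proof (rule psubsetI)
      have "col ?C k = 0\<^sub>v m" if "k < n" "col A k = 0\<^sub>v m" for k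
      proof (rule eq_vecI)
        have z: "A $$ (t, k) = 0" if "t < m" for t
          using that \<open>col A k = 0\<^sub>v m\<close> \<open>k < n\<close> less.prems
          by (metis carrier_matD index_col index_zero_vec(1))
        fix t assume "t < dim_vec (0\<^sub>v m)"
        then show "col ?C k $ t = 0\<^sub>v m $ t"
          using \<open>k < n\<close> z ij C F less.prems by (simp add: F_index)
      qed (use C in auto)
      then show "{k. k < n \<and> col ?C k \<noteq> 0\<^sub>v m} \<subseteq> {k. k < n \<and> col A k \<noteq> 0\<^sub>v m}"
        by auto
      have "col ?C j = 0\<^sub>v m"
        using ij nz C F less.prems by (intro eq_vecI) (auto simp: F_index a_def)
      moreover have "col A j \<noteq> 0\<^sub>v m"
        using ij nz less.prems by (metis carrier_matD index_col index_zero_vec(1))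
      ultimately show "{k. k < n \<and> col ?C k \<noteq> 0\<^sub>v m} \<noteq> {k. k < n \<and> col A k \<noteq> 0\<^sub>v m}"
        using ij by auto
    qed
    then have "card {k. k < n \<and> col ?C k \<noteq> 0\<^sub>v m} < card {k. k < n \<and> col A k \<noteq> 0\<^sub>v m}"
      by (intro psubset_card_mono) auto
    then obtain G where G: "G \<in> carrier_mat n m" and CGC: "?C * G * ?C = ?C"
      using less.hyps[OF _ C] by blast
    \<comment> \<open>These factors carry a generalized inverse of \<open>?C\<close> back to
      \<open>A\<close>: since \<open>A * L = R * A = ?C\<close>, the product
      \<open>A * (L * (G * R)) * A\<close> equals \<open>?C * G * ?C = ?C\<close>. The summand
      \<open>E\<close> in \<open>H\<close> then restores the part \<open>F\<close> that was
      subtracted.\<close>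
    define L R where "L = 1\<^sub>m n - E * A" and "R = 1\<^sub>m m - A * E"
    have L: "L \<in> carrier_mat n n" and R: "R \<in> carrier_mat m m"
      using E less.prems by (auto simp: L_def R_def intro!: minus_carrier_mat)
    have AL: "A * L = ?C"
      using E less.prems
      by (simp add: L_def F_def mult_minus_distrib_mat[of _ m n _ n] mult_mat_assoc_dim)
    have RA: "R * A = ?C"
      using E less.prems
      by (simp add: R_def F_def minus_mult_distrib_mat[of _ m m _ _ n] mult_mat_assoc_dim)
    define H where "H = L * (G * R) + E"
    have H: "H \<in> carrier_mat n m"
      using L R G E by (auto simp: H_def)
    have "A * H * A = A * (L * (G * R)) * A + A * E * A"
      using L R G E less.prems
      by (simp add: H_def mult_add_distrib_mat[of _ m n _ m] add_mult_distrib_mat[of _ m m _ _ n]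
        del: assoc_mult_mat)
    also have "A * (L * (G * R)) * A = (A * L) * G * (R * A)"
      using L R G E less.prems by (simp add: mult_mat_assoc_dim)
    also have "\<dots> = ?C"
      unfolding AL RA by (rule CGC)
    also have "?C + A * E * A = A"
      unfolding F_def[symmetric] using F less.prems by (intro eq_matI) auto
    finally show ?thesis
      using H by blast
  qed
qed

text \<open>\<open>A * X\<close> and \<open>A * Z\<close> are symmetric, and each acts as the
  identity on the columns of \<open>A\<close>. Transposing \<open>(A * Z) * (A * X) = A * X\<close>
  reverses the factors and yields \<open>(A * X) * (A * Z)\<close>, which is \<open>A * Z\<close>.
  The products \<open>X * A\<close> and \<open>Z * A\<close> are treated dually, and then
  \<open>X = X * A * X\<close> can be turned into \<open>Z * A * Z\<close>.\<close>

lemma is_pinv_unique: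
  assumes X: "is_pinv A X" and Z: "is_pinv A Z"
  shows "X = Z"
proof -
  have d: "dim_row X = dim_col A" "dim_col X = dim_row A"
      "dim_row Z = dim_col A" "dim_col Z = dim_row A"
    using X Z by (auto simp: is_pinv_def)
  have AX: "A * X = A * Z"
  proof -
    have "A * X = (A * X)\<^sup>T"
      using X by (simp add: is_pinv_def)
    also have "\<dots> = (A * Z * A * X)\<^sup>T"
      using Z by (simp add: is_pinv_def)
    also have "\<dots> = ((A * Z) * (A * X))\<^sup>T"
      using d by (simp add: mult_mat_assoc_dim)
    also have "\<dots> = (A * X)\<^sup>T * (A * Z)\<^sup>T"
      by (rule transpose_mult_dim) (use d in simp)
    also have "\<dots> = (A * X) * (A * Z)"
      using X Z by (simp add: is_pinv_def)
    also have "\<dots> = A * X * A * Z"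
      using d by (simp add: mult_mat_assoc_dim)
    also have "\<dots> = A * Z"
      using X by (simp add: is_pinv_def)
    finally show ?thesis .
  qed
  have XA: "X * A = Z * A"
  proof -
    have "X * A = (X * A)\<^sup>T"
      using X by (simp add: is_pinv_def)
    also have "\<dots> = (X * (A * Z * A))\<^sup>T"
      using Z by (simp add: is_pinv_def)
    also have "\<dots> = ((X * A) * (Z * A))\<^sup>T"
      using d by (simp add: mult_mat_assoc_dim)
    also have "\<dots> = (Z * A)\<^sup>T * (X * A)\<^sup>T"
      by (rule transpose_mult_dim) (use d in simp)
    also have "\<dots> = (Z * A) * (X * A)"
      using X Z by (simp add: is_pinv_def)
    also have "\<dots> = Z * (A * X * A)"
      using d by (simp add: mult_mat_assoc_dim)
    also have "\<dots> = Z * A"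
      using X by (simp add: is_pinv_def)
    finally show ?thesis .
  qed
  have "X = X * A * X"
    using X by (simp add: is_pinv_def)
  also have "\<dots> = Z * (A * X)"
    unfolding XA using d by (simp add: mult_mat_assoc_dim)
  also have "\<dots> = Z * A * Z"
    unfolding AX using d by (simp add: mult_mat_assoc_dim)
  also have "\<dots> = Z"
    using Z by (simp add: is_pinv_def)
  finally show ?thesis .
qed

text \<open>Zlobec's formula: \<open>A\<^sup>T G A\<^sup>T\<close> is the pseudoinverse for any generalized inverse \<open>G\<close>
  of \<open>A\<^sup>T A A\<^sup>T\<close>.\<close>

lemma ex_is_pinv: "\<exists>X. is_pinv A X"
proof -
  define m n where "m = dim_row A" and "n = dim_col A"
  have A: "A \<in> carrier_mat m n"
    by (simp add: m_def n_def)
  then have "A\<^sup>T * (A * A\<^sup>T) \<in> carrier_mat n m"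
    by simp
  from ex_generalized_inverse[OF this] obtain G where G: "G \<in> carrier_mat m n"
    and NGN: "A\<^sup>T * (A * A\<^sup>T) * G * (A\<^sup>T * (A * A\<^sup>T)) = A\<^sup>T * (A * A\<^sup>T)"
    by blast
  define X where "X = A\<^sup>T * (G * A\<^sup>T)"
  have X: "X \<in> carrier_mat n m"
    using A G by (simp add: X_def)
  \<comment> \<open>First cancellation: with \<open>X\<close> unfolded, \<open>NGN\<close> is this
    equation multiplied by \<open>A\<^sup>T\<close> from the left.\<close>
  have "A * (X * (A * A\<^sup>T)) = A * A\<^sup>T"
  proof (rule transpose_mult_cancel_left)
    show "A\<^sup>T * (A * (X * (A * A\<^sup>T))) = A\<^sup>T * (A * A\<^sup>T)"
      using NGN A G by (simp add: X_def mult_mat_assoc_dim)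
  qed (use A X in auto)
  then have "(A * (X * (A * A\<^sup>T)))\<^sup>T = (A * A\<^sup>T)\<^sup>T"
    by simp
  then have "A * (A\<^sup>T * (X\<^sup>T * A\<^sup>T)) = A * A\<^sup>T"
    using A X by (simp add: transpose_mult_dim mult_mat_assoc_dim)
  then have "(A\<^sup>T)\<^sup>T * (A\<^sup>T * (X\<^sup>T * A\<^sup>T)) = (A\<^sup>T)\<^sup>T * (A\<^sup>T * 1\<^sub>m m)"
    using A by simp
  \<comment> \<open>Second cancellation, applied to the transposed equation with
    \<open>A\<^sup>T\<close> in the role of \<open>A\<close>. The factor \<open>1\<^sub>m m\<close>
    only brings the right-hand side into the shape of the rule; the result is the transpose of
    \<open>A * X * A = A\<close>.\<close>
  then have tr: "A\<^sup>T * (X\<^sup>T * A\<^sup>T) = A\<^sup>T * 1\<^sub>m m"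
    by (rule transpose_mult_cancel_left[rotated 3]) (use A X in auto)
  have AXA: "A * X * A = A"
  proof -
    have "(A\<^sup>T * (X\<^sup>T * A\<^sup>T))\<^sup>T = (A\<^sup>T)\<^sup>T"
      using tr A by simp
    then show ?thesis
      using A X by (simp add: transpose_mult_dim mult_mat_assoc_dim)
  qed
  \<comment> \<open>Replacing the last factor \<open>A\<^sup>T\<close> of \<open>X\<close> by
    \<open>A\<^sup>T * (X\<^sup>T * A\<^sup>T)\<close> exhibits \<open>A * X\<close> as a matrix
    times its own transpose, which is visibly symmetric. Expanding the first factor
    \<open>A\<^sup>T\<close> does the same for \<open>X * A\<close>.\<close>
  have AX: "A * X = (A * X) * (A * X)\<^sup>T"
  proof -
    have "A * X = A * (A\<^sup>T * (G * (A\<^sup>T * (X\<^sup>T * A\<^sup>T))))"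
      unfolding tr using A by (simp add: X_def)
    also have "\<dots> = (A * X) * (A * X)\<^sup>T"
      using A X G by (simp add: X_def transpose_mult_dim mult_mat_assoc_dim)
    finally show ?thesis .
  qed
  have XA: "X * A = (X * A)\<^sup>T * (X * A)"
  proof -
    have "A\<^sup>T = (A * X * A)\<^sup>T"
      using AXA by simp
    also have "\<dots> = (X * A)\<^sup>T * A\<^sup>T"
      using A X by (simp add: transpose_mult_dim mult_mat_assoc_dim)
    finally have "A\<^sup>T * (G * (A\<^sup>T * A)) = (X * A)\<^sup>T * A\<^sup>T * (G * (A\<^sup>T * A))"
      by simp
    then show ?thesis
      using A X G by (simp add: X_def transpose_mult_dim mult_mat_assoc_dim)
  qed
  have sAX: "(A * X)\<^sup>T = A * X"
    by (subst (1 2) AX) (use A X in \<open>simp add: transpose_mult_dim mult_mat_assoc_dim\<close>)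
  have sXA: "(X * A)\<^sup>T = X * A"
    by (subst (1 2) XA) (use A X in \<open>simp add: transpose_mult_dim mult_mat_assoc_dim\<close>)
  \<comment> \<open>The same expansion of the last factor gives
    \<open>X = X * (A * X)\<^sup>T\<close>, and symmetry of \<open>A * X\<close> turns this into the
    second Penrose equation.\<close>
  have "X = A\<^sup>T * (G * (A\<^sup>T * (X\<^sup>T * A\<^sup>T)))"
    unfolding tr using A by (simp add: X_def)
  also have "\<dots> = X * (A * X)\<^sup>T"
    using A X G by (simp add: X_def transpose_mult_dim mult_mat_assoc_dim)
  also have "\<dots> = X * A * X"
    unfolding sAX using A X by (simp add: mult_mat_assoc_dim)
  finally have "is_pinv A X"
    using A X AXA sAX sXA by (simp add: is_pinv_def)
  then show ?thesis
    by blast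
qed

lemma is_pinv_pinv: "is_pinv A (pinv A)"
  unfolding pinv_def using ex_is_pinv is_pinv_unique by (metis theI)

lemma pinv_eqI: "is_pinv A X \<Longrightarrow> pinv A = X"
  using is_pinv_pinv is_pinv_unique by blast

lemma pinv_carrier: "A \<in> carrier_mat m n \<Longrightarrow> pinv A \<in> carrier_mat n m"
  using is_pinv_pinv[of A] by (auto simp: is_pinv_def)

section \<open>Orthogonal projectors\<close>

lemma is_orth_proj_unique:
  assumes Q: "is_orth_proj n V Q" and R: "is_orth_proj n V R" and V: "V \<subseteq> carrier_vec n"
  shows "Q = R"
proof (rule eq_matI)
  have QR: "Q \<in> carrier_mat n n" "R \<in> carrier_mat n n"
    using Q R by (auto simp: is_orth_proj_def)
  fix i j assume ij: "i < dim_row R" "j < dim_col R"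
  \<comment> \<open>Applying both projectors to a unit vector exposes their \<open>j\<close>-th
    columns; \<open>d\<close> is the difference of these columns.\<close>
  define v d where "v = (unit_vec n j :: real vec)" and "d = Q *\<^sub>v v - R *\<^sub>v v"
  have v: "v \<in> carrier_vec n" and d: "d \<in> carrier_vec n"
    using QR by (auto simp: v_def d_def)
  have "d \<bullet> u = 0" if "u \<in> V" for u
  proof -
    have u: "u \<in> carrier_vec n"
      using that V by blast
    have "(v - Q *\<^sub>v v) \<bullet> u = 0" "(v - R *\<^sub>v v) \<bullet> u = 0"
      using Q R v that by (auto simp: is_orth_proj_def)
    then have "v \<bullet> u = (Q *\<^sub>v v) \<bullet> u" "v \<bullet> u = (R *\<^sub>v v) \<bullet> u"
      using v QR u by (auto simp: minus_scalar_prod_distrib[of _ n])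
    then show ?thesis
      using QR v u by (simp add: d_def minus_scalar_prod_distrib[of _ n])
  qed
  moreover have "Q *\<^sub>v v \<in> V" "R *\<^sub>v v \<in> V"
    using Q R v by (auto simp: is_orth_proj_def)
  ultimately have "d \<bullet> (Q *\<^sub>v v) = 0" "d \<bullet> (R *\<^sub>v v) = 0"
    by blast+
  \<comment> \<open>Only the second \<open>d\<close> is expanded: \<open>d\<close> is orthogonal to
    \<open>Q *\<^sub>v v\<close> and to \<open>R *\<^sub>v v\<close>, hence to itself.\<close>
  then have "d \<bullet> d = 0"
    using QR v d by (subst (2) d_def) (simp add: scalar_prod_minus_distrib[of _ n])
  then have "d = 0\<^sub>v n"
    using d by (simp add: scalar_prod_self_eq_0_iff)
  then have "(Q *\<^sub>v v) $ i - (R *\<^sub>v v) $ i = 0"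
    using ij QR by (metis carrier_matD(1) d_def dim_mult_mat_vec index_minus_vec(1) index_zero_vec(1))
  then show "Q $$ (i, j) = R $$ (i, j)"
    using ij QR by (simp add: v_def)
qed (use Q R in \<open>auto simp: is_orth_proj_def\<close>)

text \<open>Symmetry of \<open>Q = X * A\<close> gives \<open>Q = A\<^sup>T * X\<^sup>T\<close>, so
  \<open>Q\<close> maps into the row space. The residual \<open>v - Q *\<^sub>v v\<close> lies in
  the kernel of \<open>A\<close> because \<open>A * Q = A\<close>, and the kernel is orthogonal to
  every \<open>A\<^sup>T *\<^sub>v x\<close>.\<close>

lemma orth_proj_row_space:
  assumes A: "A \<in> carrier_mat m n"
  shows "orth_proj n (vec_space.col_space n A\<^sup>T) = pinv A * A"
proof -
  define X Q where "X = pinv A" and "Q = X * A"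
  have X: "X \<in> carrier_mat n m" and Q: "Q \<in> carrier_mat n n"
    using A pinv_carrier[OF A] by (auto simp: X_def Q_def)
  have AXA: "A * X * A = A" and sym: "Q\<^sup>T = Q"
    using is_pinv_pinv[of A] by (auto simp: is_pinv_def X_def Q_def)
  have QA: "Q = A\<^sup>T * X\<^sup>T"
    using sym A X by (simp add: Q_def transpose_mult_dim)
  have AQ: "A * Q = A"
    using AXA A X by (simp add: Q_def)
  have V: "vec_space.col_space n A\<^sup>T = {y \<in> carrier_vec n. \<exists>x \<in> carrier_vec m. A\<^sup>T *\<^sub>v x = y}"
    using A vec_space.col_space_eq[of "A\<^sup>T" n m] by simp
  have "is_orth_proj n (vec_space.col_space n A\<^sup>T) Q"
    unfolding is_orth_proj_def
  proof (intro conjI ballI)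
    fix v :: "real vec" assume v: "v \<in> carrier_vec n"
    have "A\<^sup>T *\<^sub>v (X\<^sup>T *\<^sub>v v) = Q *\<^sub>v v"
      unfolding QA using A X v by (intro assoc_mult_mat_vec[symmetric]) auto
    then show "Q *\<^sub>v v \<in> vec_space.col_space n A\<^sup>T"
      using Q A X v unfolding V by auto
    fix u assume "u \<in> vec_space.col_space n A\<^sup>T"
    then obtain x where x: "x \<in> carrier_vec m" and u: "u = A\<^sup>T *\<^sub>v x"
      unfolding V by auto
    have "A *\<^sub>v (v - Q *\<^sub>v v) = A *\<^sub>v v - (A * Q) *\<^sub>v v"
      using A Q v by (simp add: mult_minus_distrib_mat_vec[of _ m n])
    also have "\<dots> = 0\<^sub>v m"
      unfolding AQ using A v by auto
    finally have zero: "A *\<^sub>v (v - Q *\<^sub>v v) = 0\<^sub>v m" .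
    have "(v - Q *\<^sub>v v) \<bullet> u = u \<bullet> (v - Q *\<^sub>v v)"
      unfolding u using A Q v x by (intro comm_scalar_prod[of _ n]) auto
    also have "\<dots> = x \<bullet> (A *\<^sub>v (v - Q *\<^sub>v v))"
      unfolding u using A Q v x by (intro transpose_vec_mult_scalar[of _ m n]) auto
    finally show "(v - Q *\<^sub>v v) \<bullet> u = 0"
      using x zero by simp
  qed (rule Q)
  moreover have "vec_space.col_space n A\<^sup>T \<subseteq> carrier_vec n"
    unfolding V by auto
  ultimately show ?thesis
    unfolding orth_proj_def Q_def X_def by (intro the_equality) (auto intro: is_orth_proj_unique)
qed

section \<open>Products of stacked and juxtaposed matrices\<close>

lemma append_cols_carrier:
  "A \<in> carrier_mat m n \<Longrightarrow> B \<in> carrier_mat m k \<Longrightarrow> A @\<^sub>c B \<in> carrier_mat m (n + k)"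
  by (auto simp: append_cols_def)

text \<open>Both append operations are four-block matrices padded with empty blocks. The general
  block product therefore leaves summands with inner dimension 0, which are zero matrices.\<close>

lemma append_rows_mult_append_cols:
  fixes A B C D :: "'a :: semiring_0 mat"
  assumes "A \<in> carrier_mat m n" "B \<in> carrier_mat k n" "C \<in> carrier_mat n s" "D \<in> carrier_mat n t"
  shows "(A @\<^sub>r B) * (C @\<^sub>c D) = four_block_mat (A * C) (A * D) (B * C) (B * D)"
proof -
  have "(A @\<^sub>r B) * (C @\<^sub>c D) = four_block_mat
      (A * C + 0\<^sub>m m 0 * 0\<^sub>m 0 s) (A * D + 0\<^sub>m m 0 * 0\<^sub>m 0 t)
      (B * C + 0\<^sub>m k 0 * 0\<^sub>m 0 s) (B * D + 0\<^sub>m k 0 * 0\<^sub>m 0 t)"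
    unfolding append_rows_def append_cols_def
    using assms by (subst mult_four_block_mat[of _ m n _ 0 _ k _ _ s _ t]) auto
  moreover have "0\<^sub>m a 0 * 0\<^sub>m 0 c = (0\<^sub>m a c :: 'a mat)" for a c
    by simp
  ultimately show ?thesis
    using assms by simp
qed

lemma append_cols_mult_append_rows:
  fixes A B C D :: "'a :: semiring_0 mat"
  assumes "A \<in> carrier_mat n s" "B \<in> carrier_mat n t" "C \<in> carrier_mat s k" "D \<in> carrier_mat t k"
  shows "(A @\<^sub>c B) * (C @\<^sub>r D) = A * C + B * D"
proof -
  have "(A @\<^sub>c B) * (C @\<^sub>r D) = four_block_mat
      (A * C + B * D) (A * 0\<^sub>m s 0 + B * 0\<^sub>m t 0)
      (0\<^sub>m 0 s * C + 0\<^sub>m 0 t * D) (0\<^sub>m 0 s * 0\<^sub>m s 0 + 0\<^sub>m 0 t * 0\<^sub>m t 0)"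
    unfolding append_rows_def append_cols_def
    using assms by (subst mult_four_block_mat[of _ n s _ t _ 0 _ _ k _ 0]) auto
  then show ?thesis
    using assms by (auto intro!: eq_matI)
qed

lemma mult_append_cols:
  fixes A B C :: "'a :: semiring_0 mat"
  assumes "C \<in> carrier_mat k m" "A \<in> carrier_mat m s" "B \<in> carrier_mat m t"
  shows "C * (A @\<^sub>c B) = C * A @\<^sub>c C * B"
proof (rule eq_matI)
  note AB = append_cols_carrier[OF assms(2,3)]
  fix i j assume ij: "i < dim_row (C * A @\<^sub>c C * B)" "j < dim_col (C * A @\<^sub>c C * B)"
  have "col (A @\<^sub>c B) j = (if j < s then col A j else col B (j - s))"
    using assms ij AB by (intro eq_vecI) (auto simp: append_cols_def)
  then show "(C * (A @\<^sub>c B)) $$ (i, j) = (C * A @\<^sub>c C * B) $$ (i, j)"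
    using assms ij AB by (auto simp: append_cols_def)
qed (use assms in \<open>auto simp: append_cols_def\<close>)

lemma append_rows_mult:
  fixes A B C :: "'a :: semiring_0 mat"
  assumes "A \<in> carrier_mat s m" "B \<in> carrier_mat t m" "C \<in> carrier_mat m k"
  shows "(A @\<^sub>r B) * C = A * C @\<^sub>r B * C"
proof (rule eq_matI)
  note AB = carrier_append_rows[OF assms(1,2)]
  fix i j assume ij: "i < dim_row (A * C @\<^sub>r B * C)" "j < dim_col (A * C @\<^sub>r B * C)"
  have "row (A @\<^sub>r B) i = (if i < s then row A i else row B (i - s))"
    using assms ij AB by (intro eq_vecI) (auto simp: append_rows_def)
  then show "((A @\<^sub>r B) * C) $$ (i, j) = (A * C @\<^sub>r B * C) $$ (i, j)"
    using assms ij AB by (auto simp: append_rows_def)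
qed (use assms in \<open>auto simp: append_rows_def\<close>)

section \<open>Pseudoinverse of a stack with orthogonal row spaces\<close>

text \<open>Orthogonality of the rows kills the cross terms \<open>A * pinv B\<close> and
  \<open>B * pinv A\<close>. The stack times the candidate is then block diagonal, and the candidate
  times the stack is the sum of the two row-space projectors, so the Penrose equations reduce to
  those of \<open>A\<close> and \<open>B\<close>.\<close>

lemma pinv_append_rows_orthogonal:
  assumes A: "A \<in> carrier_mat m n" and B: "B \<in> carrier_mat k n" and orth: "A * B\<^sup>T = 0\<^sub>m m k"
  shows "pinv (A @\<^sub>r B) = pinv A @\<^sub>c pinv B"
proof (rule pinv_eqI)
  define X Z where "X = pinv A" and "Z = pinv B"
  have X: "X \<in> carrier_mat n m" and Z: "Z \<in> carrier_mat n k"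
    using pinv_carrier A B by (auto simp: X_def Z_def)
  have pX: "A * X * A = A" "X * A * X = X" "(A * X)\<^sup>T = A * X" "(X * A)\<^sup>T = X * A"
    using is_pinv_pinv[of A] by (auto simp: is_pinv_def X_def)
  have pZ: "B * Z * B = B" "Z * B * Z = Z" "(B * Z)\<^sup>T = B * Z" "(Z * B)\<^sup>T = Z * B"
    using is_pinv_pinv[of B] by (auto simp: is_pinv_def Z_def)
  have orth': "B * A\<^sup>T = 0\<^sub>m k m"
    using arg_cong[OF orth, of transpose_mat] A B by (simp add: transpose_mult_dim)
  \<comment> \<open>Writing \<open>Z = Z * B * Z\<close> with the symmetric factor
    \<open>Z * B\<close> transposed puts \<open>B\<^sup>T\<close> in front, next to
    \<open>A\<close>.\<close>
  have "A * Z = A * ((Z * B)\<^sup>T * Z)"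
    by (simp add: pZ)
  also have "\<dots> = A * B\<^sup>T * (Z\<^sup>T * Z)"
    using A B Z by (simp add: transpose_mult_dim mult_mat_assoc_dim)
  finally have AZ: "A * Z = 0\<^sub>m m k"
    unfolding orth using Z by simp
  have "B * X = B * ((X * A)\<^sup>T * X)"
    by (simp add: pX)
  also have "\<dots> = B * A\<^sup>T * (X\<^sup>T * X)"
    using A B X by (simp add: transpose_mult_dim mult_mat_assoc_dim)
  finally have BX: "B * X = 0\<^sub>m k m"
    unfolding orth' using X by simp
  have MX: "(A @\<^sub>r B) * (X @\<^sub>c Z) = four_block_mat (A * X) (0\<^sub>m m k) (0\<^sub>m k m) (B * Z)"
    using append_rows_mult_append_cols[OF A B X Z] by (simp add: AZ BX)
  have XM: "(X @\<^sub>c Z) * (A @\<^sub>r B) = X * A + Z * B"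
    by (rule append_cols_mult_append_rows[OF X Z A B])
  have XAZB: "X * A + Z * B \<in> carrier_mat n n"
    using A B X Z by simp
  have "(A @\<^sub>r B) * (X @\<^sub>c Z) * (A @\<^sub>r B) = (A @\<^sub>r B) * (X * A + Z * B)"
    unfolding XM[symmetric] using A B X Z
    by (intro assoc_mult_mat[of _ "m + k" n _ "m + k" _ n]) (auto intro: append_cols_carrier)
  also have "\<dots> = A * (X * A + Z * B) @\<^sub>r B * (X * A + Z * B)"
    by (rule append_rows_mult[OF A B XAZB])
  also have "A * (X * A + Z * B) = A * X * A + A * Z * B"
    using A B X Z by (simp add: mult_add_distrib_mat[of _ m n _ n])
  also have "\<dots> = A"
    unfolding pX AZ using A B by simp
  also have "B * (X * A + Z * B) = B * X * A + B * Z * B"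
    using A B X Z by (simp add: mult_add_distrib_mat[of _ k n _ n])
  also have "\<dots> = B"
    unfolding pZ BX using A B by simp
  finally have MXM: "(A @\<^sub>r B) * (X @\<^sub>c Z) * (A @\<^sub>r B) = A @\<^sub>r B" .
  have "(X @\<^sub>c Z) * (A @\<^sub>r B) * (X @\<^sub>c Z) = (X * A + Z * B) * X @\<^sub>c (X * A + Z * B) * Z"
    unfolding XM by (rule mult_append_cols[OF XAZB X Z])
  also have "(X * A + Z * B) * X = X * A * X + Z * (B * X)"
    using A B X Z by (simp add: add_mult_distrib_mat[of _ n n _ _ m])
  also have "\<dots> = X"
    unfolding pX BX using X Z by simp
  also have "(X * A + Z * B) * Z = X * (A * Z) + Z * B * Z"
    using A B X Z by (simp add: add_mult_distrib_mat[of _ n n _ _ k])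
  also have "\<dots> = Z"
    unfolding pZ AZ using X Z by simp
  finally have XMX: "(X @\<^sub>c Z) * (A @\<^sub>r B) * (X @\<^sub>c Z) = X @\<^sub>c Z" .
  have "((A @\<^sub>r B) * (X @\<^sub>c Z))\<^sup>T = (A @\<^sub>r B) * (X @\<^sub>c Z)"
    unfolding MX using A B X Z
    by (subst transpose_four_block_mat[of _ m m _ k _ k]) (auto simp: pX pZ)
  moreover have "((X @\<^sub>c Z) * (A @\<^sub>r B))\<^sup>T = (X @\<^sub>c Z) * (A @\<^sub>r B)"
    unfolding XM using A B X Z by (subst transpose_add[of _ n n]) (auto simp: pX pZ)
  moreover have "X @\<^sub>c Z \<in> carrier_mat (dim_col (A @\<^sub>r B)) (dim_row (A @\<^sub>r B))"
    using A B append_cols_carrier[OF X Z] by (simp add: append_rows_def)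
  ultimately show "is_pinv (A @\<^sub>r B) (pinv A @\<^sub>c pinv B)"
    unfolding is_pinv_def X_def[symmetric] Z_def[symmetric] using MXM XMX by blast
qed

section \<open>The extended system and its projected rows\<close>

lemma row_block_mult_eq_0:
  fixes A C :: "'a :: semiring_0 mat"
  assumes A: "A \<in> carrier_mat m n" and C: "C \<in> carrier_mat n k" and eq: "A * C = 0\<^sub>m m k"
    and u: "u \<le> m"
  shows "row_block A l u * C = 0\<^sub>m (u - l) k"
proof (rule eq_matI)
  have RB: "row_block A l u = mat (u - l) n (\<lambda>(i, j). A $$ (l + i, j))"
    using A u by (simp add: row_block_eq)
  fix i j assume ij: "i < dim_row (0\<^sub>m (u - l) k)" "j < dim_col (0\<^sub>m (u - l) k)"
  then have "(row_block A l u * C) $$ (i, j) = (A * C) $$ (l + i, j)"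
    using A C u by (simp add: RB scalar_prod_def)
  then show "(row_block A l u * C) $$ (i, j) = 0\<^sub>m (u - l) k $$ (i, j)"
    using ij u by (simp add: eq)
qed (use A C u in \<open>auto simp: row_block_eq\<close>)

text \<open>The function \<open>r\<close> lists the block boundaries: block \<open>i\<close> starts
  in row \<open>r i\<close>, and strict increase makes every block nonempty. The carriers of
  \<open>B\<close> and \<open>S\<close> determine where \<open>W\<close> is cut.\<close>

theorem proposition2:
  fixes A \<Gamma> Abar P Y W B S :: "real mat" and b f :: "real vec"
    and m n q p :: nat and r :: "nat \<Rightarrow> nat"
  assumes A: "A \<in> carrier_mat m n"
    and b: "b \<in> vec_space.col_space m A"
    and \<Gamma>: "\<Gamma> \<in> carrier_mat m q"
    and Abar: "Abar = A @\<^sub>c \<Gamma>"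
    and blocks: "r 0 = 0" "r p = m" "\<And>i. i < p \<Longrightarrow> r i < r (Suc i)"
    and orth: "\<And>i j. i < p \<Longrightarrow> j < p \<Longrightarrow> i \<noteq> j \<Longrightarrow>
      row_block Abar (r i) (r (Suc i)) * (row_block Abar (r j) (r (Suc j)))\<^sup>T
        = 0\<^sub>m (r (Suc i) - r i) (r (Suc j) - r j)"
    and P: "P = orth_proj (n + q) (vec_space.col_space (n + q) Abar\<^sup>T)"
    and Y: "Y = 0\<^sub>m q n @\<^sub>c 1\<^sub>m q"
    and W: "W = Y * (1\<^sub>m (n + q) - P)"
    and B: "B \<in> carrier_mat q n" and S: "S \<in> carrier_mat q q"
    and WBS: "W = B @\<^sub>c S"
    and f: "f = - (Y *\<^sub>v (pinv Abar *\<^sub>v b))"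
  shows
    "P = pinv Abar * Abar
     \<and>
     (Abar * W\<^sup>T = 0\<^sub>m m q
       \<and> (\<forall>i<p. row_block Abar (r i) (r (Suc i)) * W\<^sup>T = 0\<^sub>m (r (Suc i) - r i) q))
     \<and>
     (pinv (Abar @\<^sub>r W) = pinv Abar @\<^sub>c pinv W
       \<and> W * W\<^sup>T = B * B\<^sup>T + S ^\<^sub>m 2
       \<and> B * B\<^sup>T + S ^\<^sub>m 2 = S
       \<and> S = Y * (1\<^sub>m (n + q) - P) * Y\<^sup>T)
     \<and>
     (invertible_mat S \<longrightarrow>
       (\<forall>x. is_solution A b x \<longrightarrow>
          is_solution (four_block_mat A \<Gamma> B S) (b @\<^sub>v f) (x @\<^sub>v 0\<^sub>v q))
       \<and> (\<forall>x \<in> carrier_vec n. \<forall>y \<in> carrier_vec q.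
          is_min_norm_solution (four_block_mat A \<Gamma> B S) (b @\<^sub>v f) (x @\<^sub>v y) \<longrightarrow>
            y = 0\<^sub>v q \<and> is_solution A b x))"
proof -
  let ?N = "n + q"
  define X where "X = pinv Abar"
  have AG: "Abar \<in> carrier_mat m ?N"
    unfolding Abar by (rule append_cols_carrier[OF A \<Gamma>])
  have X: "X \<in> carrier_mat ?N m"
    unfolding X_def by (rule pinv_carrier[OF AG])
  have PX: "P = X * Abar"
    unfolding P X_def by (rule orth_proj_row_space[OF AG])
  have Pc: "P \<in> carrier_mat ?N ?N"
    using X AG by (simp add: PX)
  have pX: "Abar * X * Abar = Abar" "P\<^sup>T = P"
    using is_pinv_pinv[of Abar] by (auto simp: is_pinv_def X_def[symmetric] PX)
  have Yc: "Y \<in> carrier_mat q ?N"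
    unfolding Y by (rule append_cols_carrier) auto
  define Q where "Q = 1\<^sub>m ?N - P"
  have Qc: "Q \<in> carrier_mat ?N ?N"
    using Pc unfolding Q_def by (intro minus_carrier_mat)
  have QT: "Q\<^sup>T = Q"
    using Pc pX(2) by (simp add: Q_def transpose_minus[of _ ?N ?N])
  have AP: "Abar * P = Abar"
    using pX(1) AG X by (simp add: PX)
  have PP: "P * P = P"
  proof -
    have "P * P = X * (Abar * P)"
      using AG X by (simp add: PX mult_mat_assoc_dim)
    then show ?thesis
      by (simp only: AP PX[symmetric])
  qed
  have AQ: "Abar * Q = 0\<^sub>m m ?N"
    using AG Pc AP by (simp add: Q_def mult_minus_distrib_mat[of _ m ?N _ ?N])
  have PQ: "P * Q = 0\<^sub>m ?N ?N"
    using Pc PP by (simp add: Q_def mult_minus_distrib_mat[of _ ?N ?N _ ?N])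
  have QQ: "Q * Q = Q"
  proof -
    have "Q * Q = Q - P * Q"
      using Pc Qc by (subst (1) Q_def) (simp add: minus_mult_distrib_mat[of _ ?N ?N _ _ ?N])
    then show ?thesis
      unfolding PQ using Qc by auto
  qed
  have WQ: "W = Y * Q"
    by (simp add: W Q_def)
  have Wc: "W \<in> carrier_mat q ?N"
    using Yc Qc by (simp add: WQ)
  have WT: "W\<^sup>T = Q * Y\<^sup>T"
    using Yc Qc QT by (simp add: WQ transpose_mult_dim)
  have AW: "Abar * W\<^sup>T = 0\<^sub>m m q"
  proof -
    have "Abar * W\<^sup>T = Abar * Q * Y\<^sup>T"
      using AG Qc Yc by (simp add: WT mult_mat_assoc_dim)
    then show ?thesis
      using AQ Yc by simp
  qed
  have block: "row_block Abar (r i) (r (Suc i)) * W\<^sup>T = 0\<^sub>m (r (Suc i) - r i) q" if "i < p" for i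
  proof -
    from that have "Suc i \<le> p"
      by simp
    \<comment> \<open>Induction downwards from \<open>p\<close>, using the increase of
      \<open>r\<close> at each index below \<open>p\<close>.\<close>
    then have "r (Suc i) \<le> r p"
    proof (induction rule: inc_induct)
      case (step j)
      then show ?case
        using blocks(3)[of j] by linarith
    qed simp
    then have u: "r (Suc i) \<le> m"
      by (simp add: blocks)
    show ?thesis
      by (rule row_block_mult_eq_0[OF AG _ AW u]) (use Wc in simp)
  qed
  have YT: "Y\<^sup>T = 0\<^sub>m n q @\<^sub>r 1\<^sub>m q"
    unfolding Y append_cols_def append_rows_def
    by (subst transpose_four_block_mat[of _ q n _ q _ 0]) auto
  \<comment> \<open>Multiplication by \<open>Y\<^sup>T\<close> from the right selects the last
    \<open>q\<close> columns.\<close>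
  have SY: "S = W * Y\<^sup>T"
    unfolding WBS YT using B S by (subst append_cols_mult_append_rows) auto
  have WW: "W * W\<^sup>T = S"
  proof -
    have "W * W\<^sup>T = Y * (Q * Q) * Y\<^sup>T"
      using Yc Qc unfolding WT by (simp add: WQ mult_mat_assoc_dim)
    then show ?thesis
      unfolding QQ SY WQ .
  qed
  \<comment> \<open>The block product gives \<open>B * B\<^sup>T + S * S\<^sup>T\<close>; symmetry
    of \<open>S\<close>, inherited from \<open>W * W\<^sup>T\<close>, turns the second summand into
    a square.\<close>
  have ST: "S\<^sup>T = S"
    using Wc by (simp add: WW[symmetric] transpose_mult_dim)
  have "(B @\<^sub>c S)\<^sup>T = B\<^sup>T @\<^sub>r S\<^sup>T"
    unfolding append_cols_def append_rows_def
    using B S by (subst transpose_four_block_mat[of _ q n _ q _ 0]) auto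
  then have WBB: "W * W\<^sup>T = B * B\<^sup>T + S ^\<^sub>m 2"
    unfolding WBS using B S ST by (simp add: append_cols_mult_append_rows[of _ q n _ q _ q] numeral_2_eq_2)
  have M: "four_block_mat A \<Gamma> B S = Abar @\<^sub>r W"
    unfolding Abar WBS append_cols_def append_rows_def
    using A \<Gamma> B S by (intro eq_matI) auto
  have bc: "b \<in> carrier_vec m"
    using b vec_space.col_space_eq[OF A] A by auto
  have fc: "f \<in> carrier_vec q"
    using Yc X bc by (simp add: f X_def[symmetric])
  \<comment> \<open>This serves both directions: with \<open>y = 0\<^sub>v q\<close> it shows that
    the second block equation holds, and compared with
    \<open>W *\<^sub>v (x @\<^sub>v y) = f\<close> it forces \<open>y\<close> to vanish.\<close>
  have Wv: "W *\<^sub>v (x @\<^sub>v y) = y + f"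
    if x: "x \<in> carrier_vec n" and y: "y \<in> carrier_vec q" and eq: "Abar *\<^sub>v (x @\<^sub>v y) = b" for x y
  proof -
    let ?z = "x @\<^sub>v y"
    have z: "?z \<in> carrier_vec ?N"
      using x y by simp
    have "Y *\<^sub>v ?z = (0\<^sub>m q n *\<^sub>v x + 1\<^sub>m q *\<^sub>v y) @\<^sub>v (0\<^sub>m 0 n *\<^sub>v x + 0\<^sub>m 0 q *\<^sub>v y)"
      unfolding Y append_cols_def using x y by (subst four_block_mat_mult_vec[of _ q n _ q _ 0]) auto
    also have "\<dots> = y"
      using x y by (intro eq_vecI) auto
    finally have Yz: "Y *\<^sub>v ?z = y" .
    have "W *\<^sub>v ?z = Y *\<^sub>v (Q *\<^sub>v ?z)"
      unfolding WQ using Yc Qc z by simp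
    also have "Q *\<^sub>v ?z = ?z - X *\<^sub>v b"
      using z Pc X AG eq by (simp add: Q_def minus_mult_distrib_mat_vec[of _ ?N ?N] PX)
    also have "Y *\<^sub>v (?z - X *\<^sub>v b) = y - Y *\<^sub>v (X *\<^sub>v b)"
      using Yc z X bc Yz by (simp add: mult_minus_distrib_mat_vec[of _ q ?N])
    also have "\<dots> = y + f"
      using y Yc X bc by (auto simp: f X_def[symmetric])
    finally show ?thesis .
  qed
  have Av: "Abar *\<^sub>v (x @\<^sub>v 0\<^sub>v q) = A *\<^sub>v x" if x: "x \<in> carrier_vec n" for x
  proof -
    have "Abar *\<^sub>v (x @\<^sub>v 0\<^sub>v q)
        = (A *\<^sub>v x + \<Gamma> *\<^sub>v 0\<^sub>v q) @\<^sub>v (0\<^sub>m 0 n *\<^sub>v x + 0\<^sub>m 0 q *\<^sub>v 0\<^sub>v q)"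
      unfolding Abar append_cols_def using x A \<Gamma>
      by (subst four_block_mat_mult_vec[of _ m n _ q _ 0]) auto
    also have "\<dots> = A *\<^sub>v x"
      using x A \<Gamma> by (intro eq_vecI) auto
    finally show ?thesis .
  qed
  \<comment> \<open>Reading the coefficient matrix as \<open>Abar\<close> stacked on
    \<open>W\<close> splits the system into its two block equations.\<close>
  have sol: "is_solution (four_block_mat A \<Gamma> B S) (b @\<^sub>v f) z \<longleftrightarrow>
      z \<in> carrier_vec ?N \<and> Abar *\<^sub>v z = b \<and> W *\<^sub>v z = f" for z
  proof -
    have "dim_col (Abar @\<^sub>r W) = ?N"
      using carrier_append_rows[OF AG Wc] by simp
    moreover have "(Abar @\<^sub>r W) *\<^sub>v z = b @\<^sub>v f \<longleftrightarrow> Abar *\<^sub>v z = b \<and> W *\<^sub>v z = f"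
      if "z \<in> carrier_vec ?N"
      unfolding mat_mult_append[OF AG Wc that] using AG bc that
      by (intro append_vec_eq[of _ m]) auto
    ultimately show ?thesis
      unfolding M is_solution_def by auto
  qed
  have "is_solution (four_block_mat A \<Gamma> B S) (b @\<^sub>v f) (x @\<^sub>v 0\<^sub>v q)" if "is_solution A b x" for x
  proof -
    have x: "x \<in> carrier_vec n" and Ax: "A *\<^sub>v x = b"
      using that A by (auto simp: is_solution_def)
    then show ?thesis
      unfolding sol using Av[OF x] Wv[OF x] fc by simp
  qed
  moreover have "y = 0\<^sub>v q \<and> is_solution A b x"
    if x: "x \<in> carrier_vec n" and y: "y \<in> carrier_vec q"
      and min: "is_min_norm_solution (four_block_mat A \<Gamma> B S) (b @\<^sub>v f) (x @\<^sub>v y)" for x y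
  proof -
    have Az: "Abar *\<^sub>v (x @\<^sub>v y) = b" and "W *\<^sub>v (x @\<^sub>v y) = f"
      using min unfolding is_min_norm_solution_def sol by auto
    then have yf: "y + f = f"
      using Wv[OF x y] by simp
    have y0: "y = 0\<^sub>v q"
    proof (rule eq_vecI)
      fix i assume "i < dim_vec (0\<^sub>v q)"
      then show "y $ i = 0\<^sub>v q $ i"
        using arg_cong[OF yf, of "\<lambda>v. v $ i"] y fc by simp
    qed (use y in simp)
    then show ?thesis
      using Az Av[OF x] x A by (simp add: is_solution_def)
  qed
  ultimately show ?thesis
    using PX AW block pinv_append_rows_orthogonal[OF AG Wc AW] WBB WW SY
    unfolding X_def W by auto
qed

end
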